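(* Let $A$ be a linear relation in a finite-dimensional linear space $\mathfrak{H}$ over $\mathbb{C}$. Then $$|\sigma_\pi(A)|\le\dim\mathfrak{H},$$ so that, in particular, $\sigma_\pi(A)$ consists of finitely many elements.
   Context: A linear relation $A$ in a linear space $\mathfrak{H}$ over $\mathbb{C}$ is a linear subspace of $\mathfrak{H}\times\mathfrak{H}$. Put $\ker A=\{x: (x,0)\in A\}$, $\operatorname{mul}A=\{y:(0,y)\in A\}$. For $\lambda\in\mathbb{C}$, $A-\lambda=\{(x,y-\lambda x):(x,y)\in A\}$. The product of linear relations is $AB=\{(x,y): \exists z\in\mathfrak{H},\ (x,z)\in B,\ (z,y)\in A\}$, and $A^k=AA^{k-1}$ for $k\ge1$ with $A^0=I$. The root spaces are the linear subspaces $$\mathfrak{R}_\lambda(A)=\bigcup_{i=1}^\infty\ker(A-\lambda)^i\ (\lambda\in\mathbb{C}),\qquad \mathfrak{R}_\infty(A)=\bigcup_{i=1}^\infty\operatorname{mul}A^i,$$ and the singular chain space is $\mathfrak{R}_c(A)=\mathfrak{R}_0(A)\cap\mathfrak{R}_\infty(A)$. The proper point spectrum $\sigma_\pi(A)$ is the set of all $\lambda\in\mathbb{C}\cup\{\infty\}$ with $\mathfrak{R}_\lambda(A)\setminus\mathfrak{R}_c(A)\neq\emptyset$. $|\cdot|$ denotes cardinality. *)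

theory Defs
  imports "HOL-Analysis.Product_Vector"
begin

text \<open>
  The linear space is a whole type \<open>'v\<close> with an explicit complex scalar multiplication
  \<open>smul\<close>. The product \<open>AB\<close> of relations is \<^term>\<open>B O A\<close> (\<open>B\<close> acts first), so the power
  \<open>A\<^sup>k = A A\<^sup>k\<^sup>-\<^sup>1\<close> with \<open>A\<^sup>0 = I\<close> is \<^term>\<open>A ^^ k\<close>, where \<open>A ^^ Suc n = A ^^ n O A\<close>.
\<close>

definition linear_relation ::
    "(complex \<Rightarrow> 'v \<Rightarrow> 'v) \<Rightarrow> ('v::ab_group_add \<times> 'v) set \<Rightarrow> bool" where
  "linear_relation smul A \<longleftrightarrow> module.subspace (module_prod.scale smul smul) A"

definition rel_ker :: "('v::zero \<times> 'v) set \<Rightarrow> 'v set" where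
  "rel_ker A = {x. (x, 0) \<in> A}"

definition rel_mul :: "('v::zero \<times> 'v) set \<Rightarrow> 'v set" where
  "rel_mul A = {y. (0, y) \<in> A}"

definition rel_shift ::
    "(complex \<Rightarrow> 'v \<Rightarrow> 'v) \<Rightarrow> ('v::ab_group_add \<times> 'v) set \<Rightarrow> complex \<Rightarrow> ('v \<times> 'v) set" where
  "rel_shift smul A l = {(x, y - smul l x) | x y. (x, y) \<in> A}"

datatype ext_complex = Finite_point complex | Infinity_point

fun root_space ::
    "(complex \<Rightarrow> 'v \<Rightarrow> 'v) \<Rightarrow> ('v::ab_group_add \<times> 'v) set \<Rightarrow> ext_complex \<Rightarrow> 'v set" where
  "root_space smul A (Finite_point l) = (\<Union>i\<in>{1::nat..}. rel_ker (rel_shift smul A l ^^ i))"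
| "root_space smul A Infinity_point = (\<Union>i\<in>{1::nat..}. rel_mul (A ^^ i))"

definition singular_chain_space ::
    "(complex \<Rightarrow> 'v \<Rightarrow> 'v) \<Rightarrow> ('v::ab_group_add \<times> 'v) set \<Rightarrow> 'v set" where
  "singular_chain_space smul A =
     root_space smul A (Finite_point 0) \<inter> root_space smul A Infinity_point"

definition proper_point_spectrum ::
    "(complex \<Rightarrow> 'v \<Rightarrow> 'v) \<Rightarrow> ('v::ab_group_add \<times> 'v) set \<Rightarrow> ext_complex set" where
  "proper_point_spectrum smul A =
     {l. root_space smul A l - singular_chain_space smul A \<noteq> {}}"

end

theory Submission
  imports Defs
begin

text \<open>
  Write \<open>R\<^sub>c\<close> for the singular chain space. The statement follows from the linear independence
  modulo \<open>R\<^sub>c\<close> of vectors chosen from \<open>R\<^sub>\<lambda> - R\<^sub>c\<close> for distinct proper eigenvalues \<open>\<lambda>\<close>, the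
  point \<open>\<infinity>\<close> included. Two observations reduce this to the usual argument for eigenvectors of
  an operator.

  A chain witnessing that a vector outside \<open>R\<^sub>c\<close> lies in \<open>R\<^sub>\<lambda>\<close>, with \<open>\<lambda>\<close> finite, ends at
  \<open>0 \<in> R\<^sub>c\<close>; its last member outside \<open>R\<^sub>c\<close> is an eigenvector modulo \<open>R\<^sub>c\<close>, that is, it
  satisfies \<open>(x, \<lambda>x + s) \<in> A\<close> with \<open>s \<in> R\<^sub>c\<close> (\<open>root_space_eigen_mod\<close>).

  Such an eigenvector cannot lie in \<open>R\<^sub>\<infinity>\<close> unless it already lies in \<open>R\<^sub>c\<close>
  (\<open>eigen_mod_reachable\<close>). As \<open>R\<^sub>\<infinity>\<close> is closed under passing to images, a sum \<open>\<Sum>x\<^sub>\<lambda>\<close> of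
  eigenvectors modulo \<open>R\<^sub>c\<close> lying in \<open>R\<^sub>\<infinity>\<close> has \<open>\<Sum>\<lambda>x\<^sub>\<lambda>\<close> in \<open>R\<^sub>\<infinity>\<close> too, and the classical
  elimination of one eigenvalue after another shows that every \<open>x\<^sub>\<lambda>\<close> is in \<open>R\<^sub>c\<close>
  (\<open>eigen_mod_sum_reachable\<close>). Asking only that the sum be in \<open>R\<^sub>\<infinity>\<close>, instead of zero, makes
  the conclusion cover the point \<open>\<infinity>\<close> as well.
\<close>

section \<open>Independent families\<close>

lemma (in vector_space) family_independent:
  assumes "\<And>J c. \<lbrakk>finite J; J \<subseteq> I; (\<Sum>i\<in>J. c i *s f i) = 0\<rbrakk> \<Longrightarrow> \<forall>i\<in>J. c i = 0"
  shows "inj_on f I" and "independent (f ` I)"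
proof -
  show inj: "inj_on f I"
  proof (rule inj_onI, rule ccontr)
    fix i j assume ij: "i \<in> I" "j \<in> I" "f i = f j" "i \<noteq> j"
    define c where "c = (\<lambda>k. if k = i then 1 else - 1 :: 'a)"
    have "(\<Sum>k\<in>{i, j}. c k *s f k) = 0"
      using ij by (simp add: c_def)
    then have "\<forall>k\<in>{i, j}. c k = 0"
      using ij by (intro assms) auto
    then show False
      by (simp add: c_def)
  qed
  show "independent (f ` I)"
    unfolding independent_explicit_finite_subsets
  proof (intro allI impI ballI)
    fix S u v
    assume S: "S \<subseteq> f ` I" "finite S" "(\<Sum>v\<in>S. u v *s v) = 0" "v \<in> S"
    obtain J where J: "J \<subseteq> I" "finite J" "S = f ` J"
      using finite_subset_image[OF S(2,1)] by blast
    have "inj_on f J"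
      using inj J(1) by (rule inj_on_subset)
    then have "(\<Sum>i\<in>J. u (f i) *s f i) = 0"
      using S(3) J(3) by (simp add: sum.reindex)
    then have "\<forall>i\<in>J. u (f i) = 0"
      by (intro assms J)
    then show "u v = 0"
      using S(4) J(3) by auto
  qed
qed

section \<open>Root spaces at zero and infinity\<close>

declare root_space.simps [simp del]

locale relation_space = vector_space smul
  for smul :: "complex \<Rightarrow> 'v::ab_group_add \<Rightarrow> 'v" +
  fixes A :: "('v \<times> 'v) set"
  assumes linear: "linear_relation smul A"
begin

lemma rel_zero: "(0, 0) \<in> A"
  and rel_add: "(x, y) \<in> A \<Longrightarrow> (x', y') \<in> A \<Longrightarrow> (x + x', y + y') \<in> A"
  and rel_scale: "(x, y) \<in> A \<Longrightarrow> (smul c x, smul c y) \<in> A"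
proof -
  interpret prod: vector_space_prod smul smul
    by unfold_locales
  have sub: "prod.p.subspace A"
    using linear by (simp add: linear_relation_def)
  show "(0, 0) \<in> A"
    using prod.p.subspace_0[OF sub] by (simp add: zero_prod_def)
  show "(x, y) \<in> A \<Longrightarrow> (x', y') \<in> A \<Longrightarrow> (x + x', y + y') \<in> A"
    using prod.p.subspace_add[OF sub, of "(x, y)" "(x', y')"] by simp
  show "(x, y) \<in> A \<Longrightarrow> (smul c x, smul c y) \<in> A"
    using prod.p.subspace_scale[OF sub, of "(x, y)" c] by (simp add: prod.scale_def)
qed

lemma rel_diff: "(x, y) \<in> A \<Longrightarrow> (x', y') \<in> A \<Longrightarrow> (x - x', y - y') \<in> A"
  using rel_add[of x y "smul (- 1) x'" "smul (- 1) y'"] rel_scale[of x' y' "- 1"] by simp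

lemma rel_sum: "(\<And>i. i \<in> F \<Longrightarrow> (x i, y i) \<in> A) \<Longrightarrow> (sum x F, sum y F) \<in> A"
  by (induction F rule: infinite_finite_induct) (auto intro: rel_zero rel_add)

lemma rel_power_zero: "(0, 0) \<in> A ^^ n"
  by (induction n) (auto intro: rel_zero)

lemma rel_power_add: "(x, y) \<in> A ^^ n \<Longrightarrow> (x', y') \<in> A ^^ n \<Longrightarrow> (x + x', y + y') \<in> A ^^ n"
proof (induction n arbitrary: y y')
  case (Suc n)
  then show ?case by (fastforce intro: rel_add)
qed simp

lemma rel_power_scale: "(x, y) \<in> A ^^ n \<Longrightarrow> (smul c x, smul c y) \<in> A ^^ n"
proof (induction n arbitrary: y)
  case (Suc n)
  then show ?case by (fastforce intro: rel_scale)
qed simp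

abbreviation "reach \<equiv> root_space smul A Infinity_point"
abbreviation "coreach \<equiv> root_space smul A (Finite_point 0)"
abbreviation "chain \<equiv> singular_chain_space smul A"

text \<open>The power \<open>n = 0\<close>, which the root spaces leave out, contributes only the vector \<open>0\<close>.\<close>

lemma reach_iff: "y \<in> reach \<longleftrightarrow> (\<exists>n. (0, y) \<in> A ^^ n)"
proof
  assume "\<exists>n. (0, y) \<in> A ^^ n"
  then obtain n where "(0, y) \<in> A ^^ n" ..
  then have "(0, y) \<in> A ^^ Suc n"
    by (rule relpow_Suc_I2[OF rel_zero])
  then show "y \<in> reach"
    by (auto simp: rel_mul_def root_space.simps simp del: relpow.simps)
qed (auto simp: rel_mul_def root_space.simps)

lemma rel_shift_iff: "(x, y) \<in> rel_shift smul A l \<longleftrightarrow> (x, y + smul l x) \<in> A"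
  by (auto simp: rel_shift_def) (metis add_diff_cancel_right')

lemma coreach_iff: "x \<in> coreach \<longleftrightarrow> (\<exists>n. (x, 0) \<in> A ^^ n)"
proof -
  have shift: "rel_shift smul A 0 = A"
    by (auto simp: rel_shift_iff)
  show ?thesis
  proof
    assume "\<exists>n. (x, 0) \<in> A ^^ n"
    then obtain n where "(x, 0) \<in> A ^^ n" ..
    then have "(x, 0) \<in> A ^^ Suc n"
      by (rule relpow_Suc_I[OF _ rel_zero])
    then show "x \<in> coreach"
      by (auto simp: rel_ker_def root_space.simps shift simp del: relpow.simps)
  qed (auto simp: rel_ker_def root_space.simps shift)
qed

text \<open>Two chains of different lengths are brought to the same length by repeating
  \<open>(0, 0) \<in> A\<close> at the end where both of them are zero.\<close>

lemma subspace_reach: "subspace reach"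
proof (rule subspaceI)
  show "0 \<in> reach"
    using rel_power_zero unfolding reach_iff by blast
next
  fix x y assume "x \<in> reach" "y \<in> reach"
  then obtain m n where "(0, x) \<in> A ^^ m" "(0, y) \<in> A ^^ n"
    unfolding reach_iff by blast
  then have "(0, x) \<in> A ^^ (n + m)" "(0, y) \<in> A ^^ (m + n)"
    using rel_power_zero unfolding relpow_add by auto
  then have "(0 + 0, x + y) \<in> A ^^ (m + n)"
    by (intro rel_power_add) (simp_all add: add.commute)
  then show "x + y \<in> reach"
    unfolding reach_iff by auto
next
  fix c x assume "x \<in> reach"
  then show "smul c x \<in> reach"
    unfolding reach_iff by (metis rel_power_scale scale_zero_right)
qed

lemma subspace_coreach: "subspace coreach"
proof (rule subspaceI)
  show "0 \<in> coreach"
    using rel_power_zero unfolding coreach_iff by blast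
next
  fix x y assume "x \<in> coreach" "y \<in> coreach"
  then obtain m n where "(x, 0) \<in> A ^^ m" "(y, 0) \<in> A ^^ n"
    unfolding coreach_iff by blast
  then have "(x, 0) \<in> A ^^ (m + n)" "(y, 0) \<in> A ^^ (n + m)"
    using rel_power_zero unfolding relpow_add by auto
  then have "(x + y, 0 + 0) \<in> A ^^ (m + n)"
    by (intro rel_power_add) (simp_all add: add.commute)
  then show "x + y \<in> coreach"
    unfolding coreach_iff by auto
next
  fix c x assume "x \<in> coreach"
  then show "smul c x \<in> coreach"
    unfolding coreach_iff by (metis rel_power_scale scale_zero_right)
qed

lemma chain_iff: "x \<in> chain \<longleftrightarrow> x \<in> coreach \<and> x \<in> reach"
  by (simp add: singular_chain_space_def)

lemma subspace_chain: "subspace chain"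
  unfolding singular_chain_space_def
  by (rule subspace_inter[OF subspace_coreach subspace_reach])

lemma chain_cancel_scale:
  assumes "smul c x \<in> chain" and "c \<noteq> 0"
  shows "x \<in> chain"
  using subspace_scale[OF subspace_chain assms(1), of "inverse c"] assms(2) by simp

lemma reach_step: "x \<in> reach \<Longrightarrow> (x, y) \<in> A \<Longrightarrow> y \<in> reach"
  unfolding reach_iff by (metis relpow_Suc_I)

lemma coreach_step: "y \<in> coreach \<Longrightarrow> (x, y) \<in> A \<Longrightarrow> x \<in> coreach"
  unfolding coreach_iff by (metis relpow_Suc_I2)

section \<open>Eigenvectors modulo the singular chain space\<close>

definition eigen_mod :: "complex \<Rightarrow> 'v \<Rightarrow> bool" where
  "eigen_mod l x \<longleftrightarrow> (\<exists>s\<in>chain. (x, smul l x + s) \<in> A)"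

lemma eigen_mod_scale:
  assumes "eigen_mod l x"
  shows "eigen_mod l (smul c x)"
proof -
  obtain s where "s \<in> chain" "(x, smul l x + s) \<in> A"
    using assms by (auto simp: eigen_mod_def)
  then have "smul c s \<in> chain" "(smul c x, smul l (smul c x) + smul c s) \<in> A"
    using subspace_scale[OF subspace_chain] rel_scale[of x "smul l x + s" c]
    by (simp_all add: scale_right_distrib mult.commute)
  then show ?thesis
    by (auto simp: eigen_mod_def)
qed

text \<open>
  Walking along a chain of \<open>A - \<lambda>\<close> from \<open>x\<close> to \<open>0\<close>, one enters the singular chain space by
  some step, since \<open>0\<close> belongs to it; the vector before that step is \<open>e\<close>. This reduces
  generalised eigenvectors to eigenvectors.
\<close>

lemma root_space_eigen_mod:
  assumes "x \<in> root_space smul A (Finite_point l)" and "x \<notin> chain"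
  obtains e where "e \<notin> chain" "eigen_mod l e"
proof -
  obtain n where "(x, 0) \<in> rel_shift smul A l ^^ n"
    using assms(1) by (auto simp: rel_ker_def root_space.simps)
  then have "(x, 0) \<in> (rel_shift smul A l)\<^sup>*"
    by (rule relpow_imp_rtrancl)
  then have "x \<in> chain \<or> (\<exists>e. e \<notin> chain \<and> eigen_mod l e)"
  proof (induction rule: converse_rtrancl_induct)
    case base
    then show ?case
      using subspace_0[OF subspace_chain] by simp
  next
    case (step y z)
    then have "(y, smul l y + z) \<in> A"
      by (simp add: rel_shift_iff add.commute)
    then show ?case
      using step.IH by (auto simp: eigen_mod_def)
  qed
  then show thesis
    using assms(2) that by blast
qed

text \<open>
  The backward chain from \<open>z\<close> to \<open>0\<close> is shortened: if \<open>(v, z) \<in> A\<close> is its last step, then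
  subtracting \<open>\<lambda>\<close> times this pair from \<open>(z, \<lambda>z + s)\<close> gives \<open>(z - \<lambda>v, s) \<in> A\<close>. Hence \<open>z - \<lambda>v\<close>
  is in the singular chain space, so that \<open>v\<close> is again an eigenvector modulo that space, at a
  smaller distance from \<open>0\<close>.
\<close>

lemma eigen_mod_reachable:
  assumes "z \<in> reach" and "eigen_mod l z"
  shows "z \<in> chain"
proof -
  have "z \<in> chain" if "(0, z) \<in> A ^^ n" "eigen_mod l z" for n z
    using that
  proof (induction n arbitrary: z)
    case 0
    then show ?case
      using subspace_0[OF subspace_chain] by simp
  next
    case (Suc n)
    obtain v where v: "(0, v) \<in> A ^^ n" "(v, z) \<in> A"
      using Suc.prems(1) by auto
    obtain s where s: "s \<in> chain" "(z, smul l z + s) \<in> A"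
      using Suc.prems(2) by (auto simp: eigen_mod_def)
    have "(z - smul l v, s) \<in> A"
      using rel_diff[OF s(2) rel_scale[OF v(2), of l]] by simp
    then have co: "z - smul l v \<in> coreach"
      using s(1) coreach_step by (auto simp: chain_iff)
    have "v \<in> reach"
      using v(1) reach_iff by blast
    then have "z - smul l v \<in> reach"
      using reach_step[OF _ v(2)] subspace_diff[OF subspace_reach]
        subspace_scale[OF subspace_reach] by blast
    with co have w: "z - smul l v \<in> chain"
      by (simp add: chain_iff)
    have "(v, smul l v + (z - smul l v)) \<in> A"
      using v(2) by simp
    with w have "eigen_mod l v"
      unfolding eigen_mod_def by blast
    then have "v \<in> chain"
      using Suc.IH v(1) by blast
    then have "smul l v + (z - smul l v) \<in> chain"
      by (intro subspace_add[OF subspace_chain] subspace_scale[OF subspace_chain] w)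
    then show ?case
      by simp
  qed
  then show ?thesis
    using assms reach_iff by blast
qed

text \<open>
  The image of \<open>\<Sum>x\<^sub>\<lambda>\<close> under \<open>A\<close> contains \<open>\<Sum>\<lambda>x\<^sub>\<lambda>\<close> up to a singular chain vector. Subtracting
  \<open>\<mu>\<Sum>x\<^sub>\<lambda>\<close> removes the term of \<open>\<mu>\<close> and multiplies each other term by \<open>\<lambda> - \<mu> \<noteq> 0\<close>.
\<close>

lemma eigen_mod_sum_reachable:
  assumes "finite F" and "\<And>l. l \<in> F \<Longrightarrow> eigen_mod l (x l)" and "(\<Sum>l\<in>F. x l) \<in> reach"
  shows "\<forall>l\<in>F. x l \<in> chain"
  using assms
proof (induction F arbitrary: x rule: finite_induct)
  case (insert m F)
  have "\<forall>l\<in>insert m F. \<exists>s. s \<in> chain \<and> (x l, smul l (x l) + s) \<in> A"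
    using insert.prems(1) by (auto simp: eigen_mod_def)
  then obtain s where s: "\<And>l. l \<in> insert m F \<Longrightarrow> s l \<in> chain"
      "\<And>l. l \<in> insert m F \<Longrightarrow> (x l, smul l (x l) + s l) \<in> A"
    using bchoice by metis
  let ?z = "\<Sum>l\<in>insert m F. x l"
  have "(?z, \<Sum>l\<in>insert m F. smul l (x l) + s l) \<in> A"
    using s(2) by (rule rel_sum)
  then have "(\<Sum>l\<in>insert m F. smul l (x l) + s l) \<in> reach"
    by (rule reach_step[OF insert.prems(2)])
  moreover have "(\<Sum>l\<in>insert m F. s l) \<in> reach"
    using s(1) by (intro subspace_sum[OF subspace_reach]) (simp add: chain_iff)
  moreover have "smul m ?z \<in> reach"
    by (rule subspace_scale[OF subspace_reach insert.prems(2)])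
  ultimately have "(\<Sum>l\<in>insert m F. smul l (x l) + s l) - (\<Sum>l\<in>insert m F. s l) - smul m ?z
      \<in> reach"
    by (intro subspace_diff[OF subspace_reach])
  also have "(\<Sum>l\<in>insert m F. smul l (x l) + s l) - (\<Sum>l\<in>insert m F. s l) - smul m ?z
      = (\<Sum>l\<in>insert m F. smul (l - m) (x l))"
    by (simp only: sum.distrib scale_left_diff_distrib sum_subtractf scale_sum_right
        add_diff_cancel_right')
  also have "\<dots> = (\<Sum>l\<in>F. smul (l - m) (x l))"
    using insert.hyps by simp
  finally have "\<forall>l\<in>F. smul (l - m) (x l) \<in> chain"
    by (intro insert.IH eigen_mod_scale) (use insert.prems(1) in auto)
  then have F: "x l \<in> chain" if "l \<in> F" for l
    using that insert.hyps(2) by (metis chain_cancel_scale eq_iff_diff_eq_0)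
  have "?z - (\<Sum>l\<in>F. x l) \<in> reach"
    using F by (intro subspace_diff[OF subspace_reach] insert.prems(2) subspace_sum[OF subspace_reach])
      (simp add: chain_iff)
  then have "x m \<in> reach"
    using insert.hyps by simp
  then have "x m \<in> chain"
    using eigen_mod_reachable insert.prems(1) by blast
  with F show ?case
    by blast
qed simp

section \<open>Independence over the proper point spectrum\<close>

text \<open>
  At \<open>\<infinity>\<close> any vector of the root space can serve, without reduction to an eigenvector: the
  independence argument asks of the sum over the finite points only that it lie in \<open>R\<^sub>\<infinity>\<close>.
\<close>

fun spectral_vector :: "ext_complex \<Rightarrow> 'v \<Rightarrow> bool" where
  "spectral_vector (Finite_point l) x \<longleftrightarrow> eigen_mod l x"
| "spectral_vector Infinity_point x \<longleftrightarrow> x \<in> reach"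

lemma spectral_vector_scale: "spectral_vector p x \<Longrightarrow> spectral_vector p (smul c x)"
  by (cases p) (auto intro: eigen_mod_scale subspace_scale[OF subspace_reach])

lemma spectral_vector_exists:
  assumes "p \<in> proper_point_spectrum smul A"
  shows "\<exists>x. spectral_vector p x \<and> x \<notin> chain"
proof -
  obtain x where x: "x \<in> root_space smul A p" "x \<notin> chain"
    using assms by (auto simp: proper_point_spectrum_def)
  show ?thesis
  proof (cases p)
    case (Finite_point l)
    then show ?thesis
      using x root_space_eigen_mod[of x l] by (metis spectral_vector.simps(1))
  next
    case Infinity_point
    then show ?thesis
      using x by (auto)
  qed
qed

text \<open>
  The vector at \<open>\<infinity>\<close>, moved to the other side of the relation \<open>\<Sum>x\<^sub>p = 0\<close>, shows that the sum
  over the finite points is in \<open>R\<^sub>\<infinity>\<close>. Hence the finite terms are singular chain vectors, and then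
  so is the one at \<open>\<infinity>\<close>, being minus their sum.
\<close>

lemma spectral_vectors_sum_zero:
  assumes fin: "finite J" and vec: "\<And>p. p \<in> J \<Longrightarrow> spectral_vector p (x p)"
    and zero: "(\<Sum>p\<in>J. x p) = 0"
  shows "\<forall>p\<in>J. x p \<in> chain"
proof -
  define F where "F = {l. Finite_point l \<in> J}"
  have inj: "inj_on Finite_point F"
    by (simp add: inj_on_def)
  have J: "J - {Infinity_point} = Finite_point ` F"
  proof (rule set_eqI)
    fix p show "p \<in> J - {Infinity_point} \<longleftrightarrow> p \<in> Finite_point ` F"
      by (cases p) (auto simp: F_def)
  qed
  then have finF: "finite F"
    using fin inj by (metis finite_Diff finite_imageD)
  have split: "(\<Sum>p\<in>J. x p) = (\<Sum>l\<in>F. x (Finite_point l))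
      + (if Infinity_point \<in> J then x Infinity_point else 0)"
  proof -
    have "(\<Sum>l\<in>F. x (Finite_point l)) = (\<Sum>p\<in>J - {Infinity_point}. x p)"
      unfolding J using inj by (simp add: sum.reindex)
    then show ?thesis
      using fin by (cases "Infinity_point \<in> J") (simp_all add: sum.remove[of J Infinity_point] add.commute)
  qed
  have "(\<Sum>l\<in>F. x (Finite_point l)) = - (if Infinity_point \<in> J then x Infinity_point else 0)"
    using split zero by (simp only: eq_neg_iff_add_eq_0)
  moreover have "- (if Infinity_point \<in> J then x Infinity_point else 0) \<in> reach"
    using vec[of Infinity_point] subspace_0[OF subspace_reach]
    by (intro subspace_neg[OF subspace_reach]) simp
  ultimately have F: "\<forall>l\<in>F. x (Finite_point l) \<in> chain"
    using vec by (intro eigen_mod_sum_reachable[OF finF]) (force simp: F_def)+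
  have "x Infinity_point \<in> chain" if "Infinity_point \<in> J"
  proof -
    have "x Infinity_point = - (\<Sum>l\<in>F. x (Finite_point l))"
      using split zero that by (simp add: eq_neg_iff_add_eq_0 add.commute)
    then show ?thesis
      using F by (auto intro!: subspace_neg[OF subspace_chain] subspace_sum[OF subspace_chain])
  qed
  then show ?thesis
    using F by (metis F_def ext_complex.exhaust mem_Collect_eq)
qed

end

theorem corollary5p3:
  fixes smul :: "complex \<Rightarrow> 'v::ab_group_add \<Rightarrow> 'v"
    and Basis :: "'v set"
    and A :: "('v \<times> 'v) set"
  assumes "finite_dimensional_vector_space smul Basis"
    and "linear_relation smul A"
  shows "finite (proper_point_spectrum smul A)
       \<and> card (proper_point_spectrum smul A) \<le> vector_space.dim smul UNIV"
proof -
  interpret finite_dimensional_vector_space smul Basis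
    by (rule assms(1))
  interpret relation_space smul A
    by unfold_locales (rule assms(2))
  let ?P = "proper_point_spectrum smul A"
  obtain f where f: "\<And>p. p \<in> ?P \<Longrightarrow> spectral_vector p (f p)" "\<And>p. p \<in> ?P \<Longrightarrow> f p \<notin> chain"
    using bchoice[of ?P "\<lambda>p x. spectral_vector p x \<and> x \<notin> chain"] spectral_vector_exists by blast
  have comb: "\<forall>p\<in>J. c p = 0"
    if "finite J" "J \<subseteq> ?P" "(\<Sum>p\<in>J. smul (c p) (f p)) = 0" for J c
  proof
    fix p assume p: "p \<in> J"
    have "\<forall>p\<in>J. smul (c p) (f p) \<in> chain"
      using that f(1) by (intro spectral_vectors_sum_zero spectral_vector_scale) auto
    then show "c p = 0"
      using chain_cancel_scale[of "c p" "f p"] f(2)[of p] p that(2) by blast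
  qed
  have inj: "inj_on f ?P" and ind: "independent (f ` ?P)"
    using family_independent[of ?P f] comb by blast+
  have "finite ?P"
    using finiteI_independent[OF ind] inj by (rule finite_imageD)
  moreover have "card (f ` ?P) \<le> dim UNIV"
    using ind by (intro independent_card_le_dim) auto
  ultimately show ?thesis
    using card_image[OF inj] by simp
qed

end
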